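(* Let $\mathcal{B}$ be the set of all $\beta(1,0)$-trees and let $h:\mathcal{B}\to\mathcal{B}$ be the map defined recursively by $h(\bullet)=\bullet$, $h(\lambda_i t)=\gamma_i h(t)$ for $t\in\mathcal{B}$ and $1\le i\le \operatorname{root} t$, and $h(u\oplus v)=h(v)\oslash h(u)$ for $u,v\in\mathcal{B}\setminus\{\bullet\}$. Then $h$ is an involution, i.e. $h(h(t))=t$ for every $t\in\mathcal{B}$.
   Context: A $\beta(1,0)$-tree is a rooted plane tree (children of each node are linearly ordered left to right) whose nodes are labeled with positive integers such that: (1) leaves have label $1$; (2) the root has label equal to the sum of its children's labels; (3) any other non-leaf node has label no greater than the sum of its children's labels. The single-node tree, whose only node has label $1$, is a $\beta(1,0)$-tree and is denoted $\bullet$ (it is exempt from (2)). $\mathcal{B}$ is the set of all $\beta(1,0)$-trees. $\operatorname{root} t$ is the label of the root of $t$. The right path of $t$ is the path from the root to the rightmost leaf (always go to the last child); $\operatorname{rpath} t$ is its number of edges. Operations: - For $u,v\in\mathcal{B}\setminus\{\bullet\}$, $u\oplus v$ is the tree obtained by identifying the roots: its root label is $\operatorname{root} u+\operatorname{root} v$, and the subtrees at its root are those of $u$ followed by those of $v$. - For $t\in\mathcal{B}$ and $1\le i\le\operatorname{root} t$, $\lambda_i t$ is obtained from $t$ by adding a new root whose only child is the old root; both the new root and the old root are assigned the label $i$. - For $u,v\in\mathcal{B}\setminus\{\bullet\}$, $u\oslash v$ is obtained by identifying the rightmost leaf of $u$ with the root of $v$; the identified node gets label $1$, and all other labels are kept.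 - For $t\in\mathcal{B}\setminus\{\bullet\}$ and $1\le i\le \operatorname{rpath} t$, let $x$ be the $i$th node on the right path of $t$ (the root being the first). Then $\gamma_i t$ is obtained by attaching to $x$ a new leaf (label $1$) as the new last child of $x$, and adding $1$ to the label of each node on the path from the root to $x$ (inclusive). By convention $\gamma_1\bullet$ is the tree with two nodes, both labeled $1$. The operations $\oplus$ and $\oslash$ are associative. Every $\beta(1,0)$-tree is of exactly one of the forms $\bullet$; $\lambda_i u$ with $u\in\mathcal{B}$, $1\le i\le\operatorname{root}u$ (root has exactly one child; $i$ and $u$ are then unique); $u\oplus v$ with $u,v\neq\bullet$ (root has at least two children; the decomposition into a sum of trees of the form $\lambda_i u$ is unique). Hence the recursion determines $h$ (one has $\operatorname{rpath} h(t)=\operatorname{root} t$ for $t\ne\bullet$, so $\gamma_i h(t)$ is always defined). *)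

theory Defs
  imports Main
begin

datatype tree = Node (root: nat) (children: "tree list")

abbreviation bullet :: tree ("\<bullet>") where
  "\<bullet> \<equiv> Node 1 []"

text \<open>Label conditions on the subtree hanging from a node that is not the root of the whole tree.\<close>

fun valid_subtree :: "tree \<Rightarrow> bool" where
  "valid_subtree (Node a ts) \<longleftrightarrow>
     (if ts = [] then a = 1 else 1 \<le> a \<and> a \<le> sum_list (map root ts)) \<and>
     (\<forall>t\<in>set ts. valid_subtree t)"

text \<open>Positivity of the root label need not be required: it is a nonempty sum of positive labels.\<close>

definition beta_trees :: "tree set" ("\<B>") where
  "\<B> = {t. (if children t = [] then root t = 1 else root t = sum_list (map root (children t))) \<and>
          (\<forall>c\<in>set (children t). valid_subtree c)}"

definition oplus :: "tree \<Rightarrow> tree \<Rightarrow> tree" (infixl "\<oplus>" 65) where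
  "u \<oplus> v = Node (root u + root v) (children u @ children v)"

definition lam :: "nat \<Rightarrow> tree \<Rightarrow> tree" where
  "lam i t = Node i [Node i (children t)]"

lemma size_last_less [termination_simp]:
  "ts \<noteq> [] \<Longrightarrow> size (last ts) < Suc (size_list size ts)"
  by (meson last_in_set less_Suc_eq_le order_refl size_list_estimation')

fun oslash :: "tree \<Rightarrow> tree \<Rightarrow> tree" (infixl "\<oslash>" 70) where
  "Node a ts \<oslash> v =
     (if ts = [] then Node 1 (children v) else Node a (butlast ts @ [last ts \<oslash> v]))"

fun rpath :: "tree \<Rightarrow> nat" where
  "rpath (Node a ts) = (if ts = [] then 0 else Suc (rpath (last ts)))"

text \<open>\<open>attach i t\<close> is only meaningful for \<open>1 \<le> i \<le> rpath t\<close>;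
  the \<open>i\<close>th node of the right path then exists and is not a leaf.\<close>

fun attach :: "nat \<Rightarrow> tree \<Rightarrow> tree" where
  "attach (Suc 0) (Node a ts) = Node (a + 1) (ts @ [\<bullet>])"
| "attach (Suc (Suc i)) (Node a ts) = Node (a + 1) (butlast ts @ [attach (Suc i) (last ts)])"

definition gamma :: "nat \<Rightarrow> tree \<Rightarrow> tree" where
  "gamma i t = (if t = \<bullet> then Node 1 [\<bullet>] else attach i t)"

text \<open>A map satisfying the recursion exists.
  The witness works on the list of subtrees of the root and splits off the first one.\<close>

lemma oslash_assoc: "(u \<oslash> v) \<oslash> w = u \<oslash> (v \<oslash> w)"
proof (induction u v rule: oslash.induct)
  case (1 a ts v)
  then show ?case by (cases v) auto
qed

function h_forest :: "tree list \<Rightarrow> tree" where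
  "h_forest [] = \<bullet>"
| "h_forest [c] = gamma (root c) (h_forest (children c))"
| "h_forest (c # d # ds) = h_forest (d # ds) \<oslash> h_forest [c]"
  by pat_completeness auto
termination
proof (relation "measure (size_list size)", goal_cases)
  case (2 c)
  then show ?case by (cases c) simp
qed auto

lemma h_forest_append:
  "us \<noteq> [] \<Longrightarrow> vs \<noteq> [] \<Longrightarrow> h_forest (us @ vs) = h_forest vs \<oslash> h_forest us"
proof (induction us rule: induct_list012)
  case (2 c)
  then show ?case by (cases vs) auto
next
  case (3 c d ds)
  then show ?case by (simp add: oslash_assoc del: oslash.simps)
qed simp

lemma beta_trees_children_nonempty: "t \<in> \<B> \<Longrightarrow> t \<noteq> \<bullet> \<Longrightarrow> children t \<noteq> []"
  by (cases t) (auto simp: beta_trees_def)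

lemma h_exists:
  "\<exists>h. h \<bullet> = \<bullet> \<and>
       (\<forall>t\<in>\<B>. \<forall>i. 1 \<le> i \<and> i \<le> root t \<longrightarrow> h (lam i t) = gamma i (h t)) \<and>
       (\<forall>u\<in>\<B> - {\<bullet>}. \<forall>v\<in>\<B> - {\<bullet>}. h (u \<oplus> v) = h v \<oslash> h u)"
  by (rule exI[of _ "\<lambda>t. h_forest (children t)"])
    (auto simp: lam_def oplus_def intro!: h_forest_append dest: beta_trees_children_nonempty)

end

theory Submission
  imports Defs
begin

text \<open>
  The recursion also holds with the operations exchanged:
  \<open>h (gamma i t) = lam i (h t)\<close> and \<open>h (u \<oslash> v) = h v \<oplus> h u\<close>.
  Both follow by structural induction, because a system of exchange laws between the operations
  is invariant under the duality that swaps \<open>lam\<close> with \<open>gamma\<close> and \<open>u \<oplus> v\<close> with \<open>v \<oslash> u\<close>.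
  For example, \<open>gamma (i + 1) (lam j t) = lam (j + 1) (gamma i t)\<close> is its own dual.
  Combining the two recursions, \<open>h \<circ> h\<close> fixes \<open>\<bullet>\<close> and commutes with \<open>lam\<close> and \<open>\<oplus>\<close>.
\<close>

section \<open>Closure of the operations\<close>

lemma valid_subtree_root_pos: "valid_subtree t \<Longrightarrow> 1 \<le> root t"
  by (cases t) (auto split: if_splits)

text \<open>At an inner root the sum of the children's labels is positive, so the root equation
  implies both bounds of \<open>valid_subtree\<close>. Membership in \<B> thus becomes
  \<open>valid_subtree\<close>, which suits induction on subtrees, plus one equation.\<close>

lemma beta_trees_iff:
  "t \<in> \<B> \<longleftrightarrow> valid_subtree t \<and> (children t \<noteq> [] \<longrightarrow> root t = sum_list (map root (children t)))"
proof (cases t)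
  case (Node a ts)
  have "1 \<le> sum_list (map root ts)" if "\<forall>c\<in>set ts. valid_subtree c" "ts \<noteq> []"
    using that by (cases ts) (auto dest: valid_subtree_root_pos)
  then show ?thesis
    using Node by (auto simp: beta_trees_def)
qed

lemma beta_trees_root_pos: "t \<in> \<B> \<Longrightarrow> 1 \<le> root t"
  using valid_subtree_root_pos beta_trees_iff by blast

lemma bullet_beta: "\<bullet> \<in> \<B>"
  by (simp add: beta_trees_def)

lemma lam_beta: "t \<in> \<B> \<Longrightarrow> 1 \<le> i \<Longrightarrow> i \<le> root t \<Longrightarrow> lam i t \<in> \<B>"
  by (cases t) (auto simp: beta_trees_iff lam_def)

lemma root_oslash: "children u \<noteq> [] \<Longrightarrow> root (u \<oslash> v) = root u"
  by (cases u) simp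

lemma valid_subtree_root_1:
  assumes "v \<in> \<B>" "v \<noteq> \<bullet>"
  shows "valid_subtree (Node 1 (children v))"
proof -
  have "children v \<noteq> []"
    using assms by (rule beta_trees_children_nonempty)
  moreover have "1 \<le> sum_list (map root (children v))"
    using assms(1) calculation beta_trees_iff beta_trees_root_pos by metis
  moreover have "\<forall>c\<in>set (children v). valid_subtree c"
    using assms(1) by (simp add: beta_trees_def)
  ultimately show ?thesis
    by simp
qed

text \<open>The root label is carried along because the bound at a parent involves the label of the
  child being changed. Only the former rightmost leaf becomes an inner node, and its label 1 is at
  most the sum below it.\<close>

lemma valid_subtree_oslash:
  "valid_subtree u \<Longrightarrow> v \<in> \<B> \<Longrightarrow> v \<noteq> \<bullet> \<Longrightarrow> valid_subtree (u \<oslash> v) \<and> root (u \<oslash> v) = root u"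
proof (induction u v rule: oslash.induct)
  case (1 a ts v)
  show ?case
  proof (cases "ts = []")
    case True
    then have "a = 1"
      using "1.prems" by simp
    moreover have "valid_subtree (Node 1 (children v))"
      using "1.prems"(2,3) by (rule valid_subtree_root_1)
    ultimately show ?thesis
      using True by (simp del: valid_subtree.simps)
  next
    case False
    then obtain us c where ts: "ts = us @ [c]"
      by (metis append_butlast_last_id)
    then have "valid_subtree (c \<oslash> v) \<and> root (c \<oslash> v) = root c"
      using 1 by simp
    then show ?thesis
      using "1.prems"(1) ts by auto
  qed
qed

lemma oslash_beta:
  assumes "u \<in> \<B> - {\<bullet>}" "v \<in> \<B> - {\<bullet>}"
  shows "u \<oslash> v \<in> \<B> - {\<bullet>}"
proof (cases u)
  case (Node a ts)
  then obtain us c where ts: "ts = us @ [c]"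
    using assms beta_trees_children_nonempty[of u] by (cases ts rule: rev_cases) auto
  have "valid_subtree u" "valid_subtree c" "a = sum_list (map root ts)"
    using assms(1) Node ts by (auto simp: beta_trees_iff)
  then have "valid_subtree (u \<oslash> v)" "root (c \<oslash> v) = root c"
    using assms(2) valid_subtree_oslash by auto
  moreover have "u \<oslash> v = Node a (us @ [c \<oslash> v])"
    using Node ts by simp
  ultimately show ?thesis
    using \<open>a = _\<close> ts by (simp add: beta_trees_iff del: valid_subtree.simps)
qed

lemma rpath_oslash: "v \<in> \<B> \<Longrightarrow> rpath (u \<oslash> v) = rpath u + rpath v"
proof (induction u v rule: oslash.induct)
  case (1 a ts v)
  then show ?case by (cases v) auto
qed

lemma rpath_oplus: "children v \<noteq> [] \<Longrightarrow> rpath (u \<oplus> v) = rpath v"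
  by (cases v) (simp add: oplus_def)

lemma rpath_lam: "rpath (lam i t) = Suc (rpath t)"
  by (cases t) (simp add: lam_def)

text \<open>At each node on the path to the chosen one, the label and the sum of the children's
  labels both grow by one, so the bounds persist. The new leaf ends the right path at depth
  \<open>i\<close>.\<close>

lemma attach_properties:
  "valid_subtree t \<Longrightarrow> 1 \<le> i \<Longrightarrow> i \<le> rpath t \<Longrightarrow>
   valid_subtree (attach i t) \<and> root (attach i t) = Suc (root t) \<and> rpath (attach i t) = i"
proof (induction i t rule: attach.induct)
  case (1 a ts)
  then show ?case by (auto split: if_splits)
next
  case (2 i a ts)
  then have "ts \<noteq> []" by auto
  then obtain us c where "ts = us @ [c]"
    by (metis append_butlast_last_id)
  then show ?case
    using 2 by auto
qed simp

lemma attach_beta: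
  assumes "t \<in> \<B> - {\<bullet>}" "1 \<le> i" "i \<le> rpath t"
  shows "attach i t \<in> \<B> - {\<bullet>}"
proof (cases t)
  case (Node a ts)
  then obtain us c where ts: "ts = us @ [c]"
    using assms beta_trees_children_nonempty[of t] by (cases ts rule: rev_cases) auto
  have "root (attach i t) = sum_list (map root (children (attach i t)))"
  proof (cases "i = 1")
    case True
    then show ?thesis using assms Node ts by (auto simp: beta_trees_iff)
  next
    case False
    then obtain j where "i = Suc (Suc j)"
      using assms(2) by (metis One_nat_def Suc_le_D not0_implies_Suc)
    then show ?thesis
      using assms Node ts attach_properties[of c "Suc j"] by (auto simp: beta_trees_iff)
  qed
  then show ?thesis
    using assms attach_properties[of t i] by (auto simp: beta_trees_iff)
qed

lemma gamma_beta:
  "t \<in> \<B> - {\<bullet>} \<Longrightarrow> 1 \<le> i \<Longrightarrow> i \<le> rpath t \<Longrightarrow> gamma i t \<in> \<B> - {\<bullet>}"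
  using attach_beta by (simp add: gamma_def)

lemma root_gamma:
  "t \<in> \<B> - {\<bullet>} \<Longrightarrow> 1 \<le> i \<Longrightarrow> i \<le> rpath t \<Longrightarrow> root (gamma i t) = Suc (root t)"
  using attach_properties by (simp add: gamma_def beta_trees_iff)

lemma rpath_gamma:
  "t \<in> \<B> - {\<bullet>} \<Longrightarrow> 1 \<le> i \<Longrightarrow> i \<le> rpath t \<Longrightarrow> rpath (gamma i t) = i"
  using attach_properties by (simp add: gamma_def beta_trees_iff)

lemma gamma_bullet: "gamma i \<bullet> = lam 1 \<bullet>"
  by (simp add: gamma_def lam_def)

section \<open>Structural induction\<close>

text \<open>The cases correspond to no, one, or several subtrees at the root. The induction is on
  size because the smaller trees carry new root labels and need not be subterms.\<close>

lemma beta_trees_induct [consumes 1, case_names bullet lam oplus]: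
  assumes "t \<in> \<B>"
    and bullet: "P \<bullet>"
    and lam: "\<And>i t. t \<in> \<B> \<Longrightarrow> 1 \<le> i \<Longrightarrow> i \<le> root t \<Longrightarrow> P t \<Longrightarrow> P (lam i t)"
    and oplus: "\<And>u v. u \<in> \<B> - {\<bullet>} \<Longrightarrow> v \<in> \<B> - {\<bullet>} \<Longrightarrow> P u \<Longrightarrow> P v \<Longrightarrow> P (u \<oplus> v)"
  shows "P t"
  using assms(1)
proof (induction "size t" arbitrary: t rule: less_induct)
  case less
  obtain a ts where t: "t = Node a ts" by (cases t)
  \<comment> \<open>\<open>remdups_adj.cases\<close> serves only as a split by length 0, 1 or at
    least 2.\<close>
  consider "ts = []" | c where "ts = [c]" | c d ds where "ts = c # d # ds"
    by (cases ts rule: remdups_adj.cases) auto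
  then show ?case
  proof cases
    case 1
    then show ?thesis using less.prems t bullet by (simp add: beta_trees_def)
  next
    case (2 c)
    obtain b cs where c: "c = Node b cs" by (cases c)
    \<comment> \<open>\<open>lam\<close> overwrites the old root label, so \<open>b\<close> does not
      reveal it; the root condition of \<B> determines it.\<close>
    let ?s = "Node (if cs = [] then 1 else sum_list (map root cs)) cs"
    have "?s \<in> \<B>" and "1 \<le> b" "b \<le> root ?s" "t = lam b ?s"
      using less.prems t 2 c by (auto simp: beta_trees_def lam_def split: if_splits)
    moreover have "size ?s < size t"
      using t 2 c by simp
    ultimately show ?thesis
      using less.hyps lam by metis
  next
    case (3 c d ds)
    let ?u = "Node (root c) [c]"
    let ?v = "Node (sum_list (map root (d # ds))) (d # ds)"
    have "?u \<in> \<B> - {\<bullet>}" "?v \<in> \<B> - {\<bullet>}" "t = ?u \<oplus> ?v"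
      using less.prems t 3 by (auto simp: beta_trees_def oplus_def)
    moreover have "size ?u < size t" "size ?v < size t"
      using t 3 by auto
    ultimately show ?thesis
      using less.hyps oplus by (metis DiffD1)
  qed
qed

section \<open>Exchange laws\<close>

text \<open>The rightmost leaf of \<open>v \<oplus> u\<close> lies in \<open>u\<close>. This law is
  its own dual.\<close>

lemma oplus_oslash: "children u \<noteq> [] \<Longrightarrow> (v \<oplus> u) \<oslash> w = v \<oplus> (u \<oslash> w)"
  by (cases u) (simp add: oplus_def butlast_append)

lemma lam_bullet_oslash: "lam 1 \<bullet> \<oslash> v = lam 1 v"
  by (simp add: lam_def)

text \<open>Attaching a leaf at the root amounts to adding a single edge on the right; dual to
  \<open>lam_bullet_oslash\<close>.\<close>

lemma gamma_1_eq_oplus: "t \<in> \<B> - {\<bullet>} \<Longrightarrow> gamma 1 t = t \<oplus> lam 1 \<bullet>"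
  by (cases t) (simp add: gamma_def oplus_def lam_def)

lemma lam_oslash: "children t \<noteq> [] \<Longrightarrow> lam i t \<oslash> v = lam i (t \<oslash> v)"
  by (cases t) (simp add: lam_def)

text \<open>The right path of \<open>u \<oplus> v\<close> continues inside \<open>v\<close>, and
  root labels add up; dual to \<open>lam_oslash\<close>.\<close>

lemma gamma_oplus:
  assumes "u \<in> \<B> - {\<bullet>}" "v \<in> \<B> - {\<bullet>}" "1 \<le> i"
  shows "gamma i (u \<oplus> v) = u \<oplus> gamma i v"
proof -
  obtain a us b vs where uv: "u = Node a us" "v = Node b vs"
    using tree.exhaust by metis
  have ne: "us \<noteq> []" "vs \<noteq> []"
    using assms uv beta_trees_children_nonempty[of u] beta_trees_children_nonempty[of v] by auto
  consider "i = Suc 0" | j where "i = Suc (Suc j)"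
    using assms(3) by (metis One_nat_def Suc_le_D not0_implies_Suc)
  then show ?thesis
    using uv ne by cases (simp_all add: gamma_def oplus_def butlast_append)
qed

text \<open>The new root shifts positions on the right path by one, and both nodes labeled
  \<open>j\<close> lie on the path to the chosen node.\<close>

lemma gamma_lam:
  assumes "t \<in> \<B> - {\<bullet>}" "1 \<le> i"
  shows "gamma (Suc i) (lam j t) = lam (Suc j) (gamma i t)"
proof -
  obtain a ts where t: "t = Node a ts"
    by (cases t)
  have ne: "ts \<noteq> []"
    using assms t beta_trees_children_nonempty[of t] by auto
  consider "i = Suc 0" | k where "i = Suc (Suc k)"
    using assms(2) by (metis One_nat_def Suc_le_D not0_implies_Suc)
  then show ?thesis
    using assms(1) t ne by cases (simp_all add: gamma_def lam_def)
qed

section \<open>The dual recursion\<close>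

locale beta_recursion =
  fixes h :: "tree \<Rightarrow> tree"
  assumes h_bullet: "h \<bullet> = \<bullet>"
    and h_lam: "\<And>t i. t \<in> \<B> \<Longrightarrow> 1 \<le> i \<Longrightarrow> i \<le> root t \<Longrightarrow> h (lam i t) = gamma i (h t)"
    and h_oplus: "\<And>u v. u \<in> \<B> - {\<bullet>} \<Longrightarrow> v \<in> \<B> - {\<bullet>} \<Longrightarrow> h (u \<oplus> v) = h v \<oslash> h u"
begin

lemma h_lam_bullet: "h (lam 1 \<bullet>) = lam 1 \<bullet>"
  using h_lam[of \<bullet> 1] by (simp add: bullet_beta h_bullet gamma_bullet del: One_nat_def)

text \<open>Membership and the exchange of \<open>root\<close> with \<open>rpath\<close> need each
  other: \<open>gamma i (h t)\<close> stays in \<B> because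
  \<open>i \<le> root t = rpath (h t)\<close>. The single node has root label 1 but right path
  length 0.\<close>

lemma h_properties:
  assumes "t \<in> \<B>" "t \<noteq> \<bullet>"
  shows "h t \<in> \<B> - {\<bullet>} \<and> rpath (h t) = root t \<and> root (h t) = rpath t"
  using assms
proof (induction t rule: beta_trees_induct)
  case (lam i t)
  show ?case
  proof (cases "t = \<bullet>")
    case True
    then have "i = 1" using lam by simp
    then show ?thesis
      using True h_lam_bullet lam_beta[OF bullet_beta, of 1] by (auto simp: lam_def)
  next
    case False
    then show ?thesis
      using lam gamma_beta[of "h t" i] rpath_gamma[of "h t" i] root_gamma[of "h t" i]
      by (simp add: h_lam rpath_lam) (simp add: lam_def)
  qed
next
  case (oplus u v)
  then have "children (h v) \<noteq> []" "children v \<noteq> []"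
    using beta_trees_children_nonempty by auto
  then show ?case
    using oplus oslash_beta[of "h v" "h u"]
    by (simp add: h_oplus rpath_oslash root_oslash rpath_oplus) (simp add: oplus_def)
qed simp

lemma h_beta: "t \<in> \<B> \<Longrightarrow> h t \<in> \<B>"
  using h_properties h_bullet bullet_beta by (cases "t = \<bullet>") auto

lemma h_nonbullet: "t \<in> \<B> - {\<bullet>} \<Longrightarrow> h t \<in> \<B> - {\<bullet>}"
  using h_properties by auto

lemma lam_bullet_nonbullet: "lam 1 \<bullet> \<in> \<B> - {\<bullet>}"
  using lam_beta[OF bullet_beta, of 1] by (auto simp: lam_def)

text \<open>By induction on \<open>u\<close>, an exchange law pushes \<oslash> inside, the recursion
  of \<open>h\<close> applies, and the dual law pulls \<oplus> back out.\<close>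

lemma h_oslash:
  assumes "u \<in> \<B>" "u \<noteq> \<bullet>" and v: "v \<in> \<B> - {\<bullet>}"
  shows "h (u \<oslash> v) = h v \<oplus> h u"
  using assms(1,2)
proof (induction u rule: beta_trees_induct)
  case (lam i t)
  show ?case
  proof (cases "t = \<bullet>")
    case True
    then have "i = 1" using lam by simp
    have "h (lam 1 v) = gamma 1 (h v)"
      using v by (intro h_lam beta_trees_root_pos) auto
    then show ?thesis
      using True \<open>i = 1\<close> v
      by (metis gamma_1_eq_oplus h_lam_bullet h_nonbullet lam_bullet_oslash)
  next
    case False
    then have t: "t \<in> \<B> - {\<bullet>}" "children t \<noteq> []"
      using lam beta_trees_children_nonempty by auto
    have "h (lam i t \<oslash> v) = gamma i (h (t \<oslash> v))"
      using lam t v oslash_beta[of t v] by (simp add: lam_oslash h_lam root_oslash)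
    also have "\<dots> = h v \<oplus> gamma i (h t)"
      using lam False t v h_nonbullet by (simp add: gamma_oplus)
    finally show ?thesis using lam by (simp add: h_lam)
  qed
next
  case (oplus x y)
  then have y: "children y \<noteq> []" "children (h y) \<noteq> []"
    using beta_trees_children_nonempty h_nonbullet by auto
  have "h (x \<oplus> y \<oslash> v) = h (y \<oslash> v) \<oslash> h x"
    using oplus oslash_beta v h_oplus by simp
  \<comment> \<open>The induction hypothesis for \<open>y\<close> gives
    \<open>(h v \<oplus> h y) \<oslash> h x\<close>, which \<open>oplus_oslash\<close>
    regroups.\<close>
  also have "\<dots> = h v \<oplus> h (x \<oplus> y)"
    using oplus y by (simp add: oplus_oslash h_oplus)
  finally show ?case using y by (simp add: oplus_oslash)
qed simp

lemma h_gamma_1: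
  assumes "t \<in> \<B> - {\<bullet>}"
  shows "h (gamma 1 t) = lam 1 (h t)"
  using assms h_oplus[OF assms lam_bullet_nonbullet]
  by (metis gamma_1_eq_oplus h_lam_bullet lam_bullet_oslash)

text \<open>The index is arbitrary in the induction because passing below a \<open>lam\<close>
  lowers it by one.\<close>

lemma h_gamma:
  assumes "t \<in> \<B>" "t \<noteq> \<bullet>" "1 \<le> i" "i \<le> rpath t"
  shows "h (gamma i t) = lam i (h t)"
  using assms
proof (induction t arbitrary: i rule: beta_trees_induct)
  case (lam j s)
  show ?case
  proof (cases "i = 1")
    case True
    then show ?thesis using h_gamma_1 lam lam_beta by simp
  next
    case False
    then obtain k where i: "i = Suc k" "1 \<le> k"
      using lam by (cases i) auto
    then have k: "k \<le> rpath s" using lam by (simp add: rpath_lam)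
    then have s: "s \<in> \<B> - {\<bullet>}" using lam i by auto
    have g: "gamma k s \<in> \<B>" "root (gamma k s) = Suc (root s)"
      using gamma_beta[of s k] root_gamma[of s k] s i k by auto
    have "h (gamma i (lam j s)) = h (lam (Suc j) (gamma k s))"
      using i s by (simp add: gamma_lam)
    \<comment> \<open>The index \<open>Suc j\<close> is admissible for \<open>h_lam\<close> since
      \<open>gamma k\<close> has raised the root label of \<open>s\<close> by one as well.\<close>
    also have "\<dots> = gamma (Suc j) (lam k (h s))"
      using g lam i k s by (simp add: h_lam)
    \<comment> \<open>This is the self-dual law \<open>gamma_lam\<close> again, now with
      \<open>j\<close> as the position and \<open>k\<close> as the label.\<close>
    also have "\<dots> = lam i (h (lam j s))"
      using i s lam h_nonbullet by (simp add: gamma_lam h_lam)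
    finally show ?thesis .
  qed
next
  case (oplus u v)
  then have ne: "children v \<noteq> []" "children (h v) \<noteq> []"
    using beta_trees_children_nonempty h_nonbullet by auto
  \<comment> \<open>The whole right path below the root belongs to \<open>v\<close>, so the
    hypothesis for \<open>v\<close> covers every index.\<close>
  then have i: "i \<le> rpath v" using oplus by (simp add: rpath_oplus)
  then have "h (gamma i (u \<oplus> v)) = lam i (h v) \<oslash> h u"
    using oplus gamma_beta[of v i] by (simp add: gamma_oplus h_oplus)
  then show ?case
    using oplus ne by (simp add: lam_oslash h_oplus)
qed simp

lemma h_involution: "t \<in> \<B> \<Longrightarrow> h (h t) = t"
proof (induction t rule: beta_trees_induct)
  case (lam i t)
  show ?case
  proof (cases "t = \<bullet>")
    case True
    then show ?thesis using lam h_lam_bullet by simp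
  next
    case False
    \<comment> \<open>\<open>h_gamma\<close> applies to \<open>h t\<close> because
      \<open>i \<le> root t = rpath (h t)\<close>.\<close>
    then show ?thesis
      using lam h_properties[of t] by (simp add: h_lam h_gamma)
  qed
next
  case (oplus u v)
  then show ?case
    using h_nonbullet[of u] h_nonbullet[of v] by (simp add: h_oplus h_oslash)
qed (simp only: h_bullet)

end

theorem theorem5:
  fixes h :: "tree \<Rightarrow> tree"
  assumes "h \<bullet> = \<bullet>"
    and "\<And>t i. t \<in> \<B> \<Longrightarrow> 1 \<le> i \<Longrightarrow> i \<le> root t \<Longrightarrow> h (lam i t) = gamma i (h t)"
    and "\<And>u v. u \<in> \<B> - {\<bullet>} \<Longrightarrow> v \<in> \<B> - {\<bullet>} \<Longrightarrow> h (u \<oplus> v) = h v \<oslash> h u"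
  shows "h ` \<B> \<subseteq> \<B> \<and> (\<forall>t\<in>\<B>. h (h t) = t)"
proof -
  interpret beta_recursion h
    using assms by unfold_locales
  show ?thesis
    using h_beta h_involution by blast
qed

end
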